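(* Let $\Theta$ be the variety of all automatons. Automorphic equivalence in $\Theta$ coincides with geometric equivalence; that is, for all $H_1,H_2\in\Theta$, $H_1$ and $H_2$ are automorphically equivalent if and only if they are geometrically equivalent.
   Context: An automaton is a three-sorted algebra $H$ with sorts $\Gamma=\{1,2,3\}$: $H^{(1)}$ is the set of input signals, $H^{(2)}$ the set of states, $H^{(3)}$ the set of output signals (any of them may be empty), with two operations: $*$ of type $(1,2;2)$, giving the new state from an input signal and the previous state, and $\circ$ of type $(1,2;3)$, giving the output signal from an input signal and a state. No identities are imposed; $\Theta$ is the variety of all such algebras. A homomorphism $\varphi:A\to B$ is a sort-preserving map commuting with both operations (none exists if $A^{(i)}\neq\varnothing=B^{(i)}$ for some $i$). Let $X_0$ be a three-sorted set with countably infinitely many elements of each sort. The objects of the category $\Theta^0$ are the free algebras $F(X)$ of $\Theta$ with $X\subset X_0$ finite, the morphisms are all homomorphisms. ($F(X)$ is free if for every $A\in\Theta$ having elements of every sort occurring in $X$, every sort-preserving map $X\to A$ extends to a unique homomorphism $F(X)\to A$.) For $F\in\mathrm{Ob}\,\Theta^0$, $H\in\Theta$ and $T\subseteq\bigcup_{i\in\Gamma}(F^{(i)})^2$ put $T_H''=\bigcap\{\ker\varphi\mid\varphi\in\mathrm{Hom}(F,H),\ T\subseteq\ker\varphi\}$, where $\ker\varphi=\{(a,b)\mid\varphi(a)=\varphi(b)\}$ and the intersection of the empty family is $\bigcup_{i\in\Gamma}(F^{(i)})^2$. $T$ is algebraically closed over $H$ if $T_H''=T$; $Cl_H(F)$ is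 the family of all such algebraically closed $T$. Algebras $H_1,H_2\in\Theta$ are geometrically equivalent if $T_{H_1}''=T_{H_2}''$ for every $F\in\mathrm{Ob}\,\Theta^0$ and every $T\subseteq\bigcup_{i\in\Gamma}(F^{(i)})^2$. Algebras $H_1,H_2\in\Theta$ are automorphically equivalent if there exist an automorphism $\Phi:\Theta^0\to\Theta^0$ and bijections $\alpha(\Phi)_A:Cl_{H_1}(A)\to Cl_{H_2}(\Phi(A))$ for every $A\in\mathrm{Ob}\,\Theta^0$ such that for all $A_1,A_2\in\mathrm{Ob}\,\Theta^0$, $\mu_1,\mu_2\in\mathrm{Hom}(A_1,A_2)$ and $T\in Cl_{H_1}(A_2)$: $\tau\mu_1=\tau\mu_2$ if and only if $\widetilde\tau\Phi(\mu_1)=\widetilde\tau\Phi(\mu_2)$, where $\tau:A_2\to A_2/T$ and $\widetilde\tau:\Phi(A_2)\to\Phi(A_2)/\alpha(\Phi)_{A_2}(T)$ are the natural epimorphisms. *)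

theory Defs
  imports Main "HOL-Library.FuncSet" "HOL-Library.Countable_Set"
begin

section \<open>Automatons and homomorphisms\<close>

datatype gamma = Input | State | Output

text \<open>
  A three-sorted set is a family indexed by \<^type>\<open>gamma\<close>; the members of the family live in one
  type but are never compared across sorts, so they need not be disjoint, and any of them may
  be empty.  The operations are total functions of which only the values on the carriers matter.
\<close>

record 'a automaton =
  carrier :: "gamma \<Rightarrow> 'a set"
  star :: "'a \<Rightarrow> 'a \<Rightarrow> 'a"
  circ :: "'a \<Rightarrow> 'a \<Rightarrow> 'a"

definition is_automaton :: "'a automaton \<Rightarrow> bool" where
  "is_automaton H \<longleftrightarrow>
     (\<forall>x\<in>carrier H Input. \<forall>s\<in>carrier H State.
        star H x s \<in> carrier H State \<and> circ H x s \<in> carrier H Output)"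

text \<open>
  Homomorphisms are extensional, so that equality of functions is equality of homomorphisms.
\<close>

definition homs :: "'a automaton \<Rightarrow> 'b automaton \<Rightarrow> (gamma \<Rightarrow> 'a \<Rightarrow> 'b) set" where
  "homs A B =
     {\<phi>. (\<forall>i. \<phi> i \<in> carrier A i \<rightarrow>\<^sub>E carrier B i) \<and>
          (\<forall>x\<in>carrier A Input. \<forall>s\<in>carrier A State.
             \<phi> State (star A x s) = star B (\<phi> Input x) (\<phi> State s) \<and>
             \<phi> Output (circ A x s) = circ B (\<phi> Input x) (\<phi> State s))}"

lemma homsD:
  assumes "\<phi> \<in> homs A B"
  shows "a \<in> carrier A i \<Longrightarrow> \<phi> i a \<in> carrier B i"
    and "x \<in> carrier A Input \<Longrightarrow> s \<in> carrier A State \<Longrightarrow>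
           \<phi> State (star A x s) = star B (\<phi> Input x) (\<phi> State s)"
    and "x \<in> carrier A Input \<Longrightarrow> s \<in> carrier A State \<Longrightarrow>
           \<phi> Output (circ A x s) = circ B (\<phi> Input x) (\<phi> State s)"
  using assms by (auto simp: homs_def)

definition id_hom :: "'a automaton \<Rightarrow> gamma \<Rightarrow> 'a \<Rightarrow> 'a" where
  "id_hom A = (\<lambda>i. \<lambda>a\<in>carrier A i. a)"

definition comp_hom ::
  "'a automaton \<Rightarrow> (gamma \<Rightarrow> 'b \<Rightarrow> 'c) \<Rightarrow> (gamma \<Rightarrow> 'a \<Rightarrow> 'b) \<Rightarrow> gamma \<Rightarrow> 'a \<Rightarrow> 'c" where
  "comp_hom A g f = (\<lambda>i. compose (carrier A i) (g i) (f i))"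


section \<open>Free automatons\<close>

text \<open>
  The free automaton over \<open>X\<close> is the algebra of well-sorted terms; since no identities are
  imposed, distinct terms are distinct elements.
\<close>

datatype 'x aterm = Var 'x | Star "'x aterm" "'x aterm" | Circ "'x aterm" "'x aterm"

inductive_set terms :: "(gamma \<Rightarrow> 'x set) \<Rightarrow> (gamma \<times> 'x aterm) set"
  for X :: "gamma \<Rightarrow> 'x set" where
  Var: "x \<in> X i \<Longrightarrow> (i, Var x) \<in> terms X"
| Star: "(Input, u) \<in> terms X \<Longrightarrow> (State, v) \<in> terms X \<Longrightarrow> (State, Star u v) \<in> terms X"
| Circ: "(Input, u) \<in> terms X \<Longrightarrow> (State, v) \<in> terms X \<Longrightarrow> (Output, Circ u v) \<in> terms X"

definition free_automaton :: "(gamma \<Rightarrow> 'x set) \<Rightarrow> 'x aterm automaton" where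
  "free_automaton X = \<lparr>carrier = (\<lambda>i. {t. (i, t) \<in> terms X}), star = Star, circ = Circ\<rparr>"

lemma free_automaton_simps [simp]:
  "t \<in> carrier (free_automaton X) i \<longleftrightarrow> (i, t) \<in> terms X"
  "star (free_automaton X) = Star"
  "circ (free_automaton X) = Circ"
  by (simp_all add: free_automaton_def)

lemma is_automaton_free_automaton: "is_automaton (free_automaton X)"
  by (auto simp: is_automaton_def intro: terms.intros)

primrec eval_term :: "'a automaton \<Rightarrow> (gamma \<Rightarrow> 'x \<Rightarrow> 'a) \<Rightarrow> 'x aterm \<Rightarrow> gamma \<Rightarrow> 'a" where
  "eval_term A f (Var x) = (\<lambda>i. f i x)"
| "eval_term A f (Star u v) = (\<lambda>i. star A (eval_term A f u Input) (eval_term A f v State))"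
| "eval_term A f (Circ u v) = (\<lambda>i. circ A (eval_term A f u Input) (eval_term A f v State))"

theorem free_automaton_universal:
  fixes A :: "'a automaton" and X :: "gamma \<Rightarrow> 'x set"
  assumes A: "is_automaton A" and f: "\<And>i. f i \<in> X i \<rightarrow> carrier A i"
  shows "\<exists>!\<phi>. \<phi> \<in> homs (free_automaton X) A \<and> (\<forall>i. \<forall>x\<in>X i. \<phi> i (Var x) = f i x)"
proof (rule ex1I)
  let ?\<phi> = "\<lambda>i. \<lambda>t\<in>carrier (free_automaton X) i. eval_term A f t i"
  have "eval_term A f t i \<in> carrier A i" if "(i, t) \<in> terms X" for i t
    using that
  proof induction
    case (Var x i)
    then show ?case using f[of i] by auto
  qed (use A in \<open>auto simp: is_automaton_def\<close>)
  then show "?\<phi> \<in> homs (free_automaton X) A \<and> (\<forall>i. \<forall>x\<in>X i. ?\<phi> i (Var x) = f i x)"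
    by (auto simp: homs_def intro: terms.intros)
next
  let ?\<phi> = "\<lambda>i. \<lambda>t\<in>carrier (free_automaton X) i. eval_term A f t i"
  fix \<psi> assume \<psi>: "\<psi> \<in> homs (free_automaton X) A \<and> (\<forall>i. \<forall>x\<in>X i. \<psi> i (Var x) = f i x)"
  have eq: "\<psi> i t = eval_term A f t i" if "(i, t) \<in> terms X" for i t
    using that by induction (use \<psi> in \<open>auto simp: homs_def\<close>)
  show "\<psi> = ?\<phi>"
  proof (intro ext)
    fix i t
    show "\<psi> i t = ?\<phi> i t"
    proof (cases "(i, t) \<in> terms X")
      case False
      have "\<psi> i \<in> extensional (carrier (free_automaton X) i)"
        using \<psi> by (auto simp: homs_def PiE_def)
      then show ?thesis using False by (simp add: extensional_def)
    qed (simp add: eq)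
  qed
qed


section \<open>Categories and their automorphisms\<close>

text \<open>
  Hom-sets of different pairs of objects need not be disjoint, so the identity, the composition
  and the morphism part of a functor carry the objects as arguments:
  \<open>Comp C A B D g f\<close> is the composite of \<open>f : A \<rightarrow> B\<close> and \<open>g : B \<rightarrow> D\<close>.
\<close>

record ('o, 'm) category =
  Obj :: "'o set"
  Hom :: "'o \<Rightarrow> 'o \<Rightarrow> 'm set"
  Id :: "'o \<Rightarrow> 'm"
  Comp :: "'o \<Rightarrow> 'o \<Rightarrow> 'o \<Rightarrow> 'm \<Rightarrow> 'm \<Rightarrow> 'm"

definition is_category :: "('o, 'm) category \<Rightarrow> bool" where
  "is_category C \<longleftrightarrow>
     (\<forall>A\<in>Obj C. Id C A \<in> Hom C A A) \<and>
     (\<forall>A\<in>Obj C. \<forall>B\<in>Obj C. \<forall>D\<in>Obj C. \<forall>f\<in>Hom C A B. \<forall>g\<in>Hom C B D.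
        Comp C A B D g f \<in> Hom C A D) \<and>
     (\<forall>A\<in>Obj C. \<forall>B\<in>Obj C. \<forall>f\<in>Hom C A B.
        Comp C A A B f (Id C A) = f \<and> Comp C A B B (Id C B) f = f) \<and>
     (\<forall>A\<in>Obj C. \<forall>B\<in>Obj C. \<forall>D\<in>Obj C. \<forall>E\<in>Obj C.
        \<forall>f\<in>Hom C A B. \<forall>g\<in>Hom C B D. \<forall>h\<in>Hom C D E.
        Comp C A D E h (Comp C A B D g f) = Comp C A B E (Comp C B D E h g) f)"

record ('o, 'm, 'p, 'n) cfunctor =
  omap :: "'o \<Rightarrow> 'p"
  mmap :: "'o \<Rightarrow> 'o \<Rightarrow> 'm \<Rightarrow> 'n"

definition is_functor ::
  "('o, 'm) category \<Rightarrow> ('p, 'n) category \<Rightarrow> ('o, 'm, 'p, 'n) cfunctor \<Rightarrow> bool" where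
  "is_functor C D \<Phi> \<longleftrightarrow>
     omap \<Phi> \<in> Obj C \<rightarrow> Obj D \<and>
     (\<forall>A\<in>Obj C. \<forall>B\<in>Obj C. mmap \<Phi> A B \<in> Hom C A B \<rightarrow> Hom D (omap \<Phi> A) (omap \<Phi> B)) \<and>
     (\<forall>A\<in>Obj C. mmap \<Phi> A A (Id C A) = Id D (omap \<Phi> A)) \<and>
     (\<forall>A1\<in>Obj C. \<forall>A2\<in>Obj C. \<forall>A3\<in>Obj C. \<forall>f\<in>Hom C A1 A2. \<forall>g\<in>Hom C A2 A3.
        mmap \<Phi> A1 A3 (Comp C A1 A2 A3 g f) =
        Comp D (omap \<Phi> A1) (omap \<Phi> A2) (omap \<Phi> A3) (mmap \<Phi> A2 A3 g) (mmap \<Phi> A1 A2 f))"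

definition left_inverse_functor ::
  "('o, 'm) category \<Rightarrow> ('o, 'm, 'p, 'n) cfunctor \<Rightarrow> ('p, 'n, 'o, 'm) cfunctor \<Rightarrow> bool" where
  "left_inverse_functor C \<Phi> \<Psi> \<longleftrightarrow>
     (\<forall>A\<in>Obj C. omap \<Psi> (omap \<Phi> A) = A) \<and>
     (\<forall>A\<in>Obj C. \<forall>B\<in>Obj C. \<forall>f\<in>Hom C A B.
        mmap \<Psi> (omap \<Phi> A) (omap \<Phi> B) (mmap \<Phi> A B f) = f)"

definition category_automorphism ::
  "('o, 'm) category \<Rightarrow> ('o, 'm, 'o, 'm) cfunctor \<Rightarrow> bool" where
  "category_automorphism C \<Phi> \<longleftrightarrow>
     is_functor C C \<Phi> \<and>
     (\<exists>\<Psi>. is_functor C C \<Psi> \<and> left_inverse_functor C \<Phi> \<Psi> \<and> left_inverse_functor C \<Psi> \<Phi>)"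


section \<open>The category of finitely generated free automatons\<close>

definition Theta0 ::
  "(gamma \<Rightarrow> 'x set) \<Rightarrow> ('x aterm automaton, gamma \<Rightarrow> 'x aterm \<Rightarrow> 'x aterm) category" where
  "Theta0 X0 =
     \<lparr>Obj = {free_automaton X | X. \<forall>i. X i \<subseteq> X0 i \<and> finite (X i)},
      Hom = homs,
      Id = id_hom,
      Comp = (\<lambda>A B D g f. comp_hom A g f)\<rparr>"

lemma is_category_Theta0: "is_category (Theta0 X0)"
proof -
  have id: "id_hom A \<in> homs A A" if "is_automaton A" for A :: "'x aterm automaton"
    using that by (auto simp: homs_def id_hom_def is_automaton_def)
  have comp: "comp_hom A g f \<in> homs A D"
    if "is_automaton A" "f \<in> homs A B" "g \<in> homs B D" for A B D :: "'x aterm automaton" and f g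
    using that(1) homsD[OF that(2)] homsD[OF that(3)]
    by (auto simp: homs_def comp_hom_def compose_def is_automaton_def)
  have unit: "comp_hom A f (id_hom A) = f \<and> comp_hom A (id_hom B) f = f"
    if "f \<in> homs A B" for A B :: "'x aterm automaton" and f
    using that
    by (auto simp: homs_def comp_hom_def id_hom_def compose_def fun_eq_iff PiE_iff extensional_def
        restrict_def)
  have assoc: "comp_hom A h (comp_hom A g f) = comp_hom A (comp_hom B h g) f"
    if "f \<in> homs A B" for A B :: "'x aterm automaton" and f g h
    using that by (auto simp: homs_def comp_hom_def compose_def fun_eq_iff PiE_iff restrict_def)
  have ob: "is_automaton A" if "A \<in> Obj (Theta0 X0)" for A
    using that by (auto simp: Theta0_def is_automaton_free_automaton)
  show ?thesis
    unfolding is_category_def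
  proof (intro conjI ballI)
    fix A assume "A \<in> Obj (Theta0 X0)"
    then show "Id (Theta0 X0) A \<in> Hom (Theta0 X0) A A"
      using id[OF ob] by (simp add: Theta0_def)
  next
    fix A B D f g
    assume "A \<in> Obj (Theta0 X0)" "f \<in> Hom (Theta0 X0) A B" "g \<in> Hom (Theta0 X0) B D"
    then show "Comp (Theta0 X0) A B D g f \<in> Hom (Theta0 X0) A D"
      using comp[OF ob, of A f B g D] by (simp add: Theta0_def)
  next
    fix A B f
    assume "f \<in> Hom (Theta0 X0) A B"
    then show "Comp (Theta0 X0) A A B f (Id (Theta0 X0) A) = f"
      "Comp (Theta0 X0) A B B (Id (Theta0 X0) B) f = f"
      using unit[of f A B] by (simp_all add: Theta0_def)
  next
    fix A B D E f g h
    assume "f \<in> Hom (Theta0 X0) A B"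
    then show "Comp (Theta0 X0) A D E h (Comp (Theta0 X0) A B D g f) =
        Comp (Theta0 X0) A B E (Comp (Theta0 X0) B D E h g) f"
      using assoc[of f A B h g] by (simp add: Theta0_def)
  qed
qed


section \<open>Algebraically closed relations and equivalences of automatons\<close>

text \<open>
  A subset \<open>T\<close> of the (disjoint) union of the squares of the sorts of \<open>F\<close> is a family of
  relations; inclusion and intersection are the pointwise ones on families.
\<close>

definition full_rel :: "'a automaton \<Rightarrow> gamma \<Rightarrow> ('a \<times> 'a) set" where
  "full_rel F = (\<lambda>i. carrier F i \<times> carrier F i)"

definition hom_ker :: "'a automaton \<Rightarrow> (gamma \<Rightarrow> 'a \<Rightarrow> 'b) \<Rightarrow> gamma \<Rightarrow> ('a \<times> 'a) set" where
  "hom_ker F \<phi> = (\<lambda>i. {(a, b). a \<in> carrier F i \<and> b \<in> carrier F i \<and> \<phi> i a = \<phi> i b})"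

text \<open>
  Kernels are contained in \<^term>\<open>full_rel F\<close>, so the meet with \<^term>\<open>full_rel F\<close> only matters
  for the empty family, where it is the intersection by convention.
\<close>

definition alg_closure ::
  "'b automaton \<Rightarrow> 'a automaton \<Rightarrow> (gamma \<Rightarrow> ('a \<times> 'a) set) \<Rightarrow> gamma \<Rightarrow> ('a \<times> 'a) set" where
  "alg_closure H F T =
     inf (full_rel F) (INF \<phi>\<in>{\<phi> \<in> homs F H. T \<le> hom_ker F \<phi>}. hom_ker F \<phi>)"

definition Cl :: "'b automaton \<Rightarrow> 'a automaton \<Rightarrow> (gamma \<Rightarrow> ('a \<times> 'a) set) set" where
  "Cl H F = {T. T \<le> full_rel F \<and> alg_closure H F T = T}"

definition geometrically_equivalent ::
  "(gamma \<Rightarrow> 'x set) \<Rightarrow> 'a automaton \<Rightarrow> 'b automaton \<Rightarrow> bool" where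
  "geometrically_equivalent X0 H1 H2 \<longleftrightarrow>
     (\<forall>F\<in>Obj (Theta0 X0). \<forall>T. T \<le> full_rel F \<longrightarrow> alg_closure H1 F T = alg_closure H2 F T)"

definition quotient_automaton ::
  "'a automaton \<Rightarrow> (gamma \<Rightarrow> ('a \<times> 'a) set) \<Rightarrow> 'a set automaton" where
  "quotient_automaton A T =
     \<lparr>carrier = (\<lambda>i. carrier A i // T i),
      star = (\<lambda>U V. \<Union>u\<in>U. \<Union>v\<in>V. T State `` {star A u v}),
      circ = (\<lambda>U V. \<Union>u\<in>U. \<Union>v\<in>V. T Output `` {circ A u v})\<rparr>"

definition nat_epi :: "'a automaton \<Rightarrow> (gamma \<Rightarrow> ('a \<times> 'a) set) \<Rightarrow> gamma \<Rightarrow> 'a \<Rightarrow> 'a set" where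
  "nat_epi A T = (\<lambda>i. \<lambda>a\<in>carrier A i. T i `` {a})"

lemma Cl_iff:
  assumes "T \<in> Cl H A"
  shows "(a, b) \<in> T i \<longleftrightarrow> a \<in> carrier A i \<and> b \<in> carrier A i \<and>
           (\<forall>\<phi>\<in>homs A H. T \<le> hom_ker A \<phi> \<longrightarrow> \<phi> i a = \<phi> i b)"
proof -
  have "T i = alg_closure H A T i"
    using assms by (simp add: Cl_def)
  then show ?thesis
    by (auto simp: alg_closure_def full_rel_def hom_ker_def)
qed

lemma equiv_Cl:
  assumes "T \<in> Cl H A"
  shows "equiv (carrier A i) (T i)"
  by (rule equivI) (auto simp: refl_on_def sym_def trans_def Cl_iff[OF assms])

theorem nat_epi_hom:
  assumes A: "is_automaton A" and T: "T \<in> Cl H A"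
  shows "nat_epi A T \<in> homs A (quotient_automaton A T)"
    and "nat_epi A T i ` carrier A i = carrier (quotient_automaton A T) i"
proof -
  note cl = Cl_iff[OF T] and eq = equiv_Cl[OF T]
  have st: "(star A x s, star A y t) \<in> T State" and ci: "(circ A x s, circ A y t) \<in> T Output"
    if "(x, y) \<in> T Input" "(s, t) \<in> T State" for x y s t
  proof -
    have c: "x \<in> carrier A Input" "y \<in> carrier A Input" "s \<in> carrier A State" "t \<in> carrier A State"
      using that by (auto simp: cl)
    have e: "\<phi> Input x = \<phi> Input y" "\<phi> State s = \<phi> State t"
      if "\<phi> \<in> homs A H" "T \<le> hom_ker A \<phi>" for \<phi>
      using that \<open>(x, y) \<in> T Input\<close> \<open>(s, t) \<in> T State\<close> unfolding cl by blast+
    show "(star A x s, star A y t) \<in> T State" "(circ A x s, circ A y t) \<in> T Output"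
      using A c unfolding cl
      by (auto simp: is_automaton_def homsD intro!: arg_cong2[where f="star H"]
          arg_cong2[where f="circ H"] e)
  qed
  have "(\<Union>u\<in>T Input `` {x}. \<Union>v\<in>T State `` {s}. T State `` {star A u v}) = T State `` {star A x s}"
    and "(\<Union>u\<in>T Input `` {x}. \<Union>v\<in>T State `` {s}. T Output `` {circ A u v}) = T Output `` {circ A x s}"
    if "x \<in> carrier A Input" "s \<in> carrier A State" for x s
  proof -
    have "x \<in> T Input `` {x}" "s \<in> T State `` {s}"
      using that by (auto simp: cl)
    moreover have "T State `` {star A u v} = T State `` {star A x s}"
      "T Output `` {circ A u v} = T Output `` {circ A x s}"
      if "u \<in> T Input `` {x}" "v \<in> T State `` {s}" for u v
      using st[of x u s v] ci[of x u s v] that equiv_class_eq[OF eq] by blast+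
    ultimately show
      "(\<Union>u\<in>T Input `` {x}. \<Union>v\<in>T State `` {s}. T State `` {star A u v}) = T State `` {star A x s}"
      "(\<Union>u\<in>T Input `` {x}. \<Union>v\<in>T State `` {s}. T Output `` {circ A u v}) = T Output `` {circ A x s}"
      by blast+
  qed
  then show "nat_epi A T \<in> homs A (quotient_automaton A T)"
    using A by (auto simp: homs_def nat_epi_def quotient_automaton_def is_automaton_def quotientI)
  show "nat_epi A T i ` carrier A i = carrier (quotient_automaton A T) i"
    by (auto simp: nat_epi_def quotient_automaton_def quotient_def)
qed

definition automorphically_equivalent ::
  "(gamma \<Rightarrow> 'x set) \<Rightarrow> 'a automaton \<Rightarrow> 'b automaton \<Rightarrow> bool" where
  "automorphically_equivalent X0 H1 H2 \<longleftrightarrow>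
     (\<exists>\<Phi> \<alpha>.
        category_automorphism (Theta0 X0) \<Phi> \<and>
        (\<forall>A\<in>Obj (Theta0 X0). bij_betw (\<alpha> A) (Cl H1 A) (Cl H2 (omap \<Phi> A))) \<and>
        (\<forall>A1\<in>Obj (Theta0 X0). \<forall>A2\<in>Obj (Theta0 X0). \<forall>\<mu>1\<in>homs A1 A2. \<forall>\<mu>2\<in>homs A1 A2. \<forall>T\<in>Cl H1 A2.
           comp_hom A1 (nat_epi A2 T) \<mu>1 = comp_hom A1 (nat_epi A2 T) \<mu>2 \<longleftrightarrow>
           comp_hom (omap \<Phi> A1) (nat_epi (omap \<Phi> A2) (\<alpha> A2 T)) (mmap \<Phi> A1 A2 \<mu>1) =
           comp_hom (omap \<Phi> A1) (nat_epi (omap \<Phi> A2) (\<alpha> A2 T)) (mmap \<Phi> A1 A2 \<mu>2)))"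

end

theory Submission
  imports Defs
begin

text \<open>
  An automorphism \<open>\<Phi>\<close> of the category preserves non-emptiness and size of hom-sets, and these
  single out, up to renaming of the generator, the free automatons \<open>sg i\<close> on one generator of sort
  \<open>i\<close>.  Identifying \<open>a \<in> A i\<close> with the homomorphism \<open>sg i \<rightarrow> A\<close> that hits \<open>a\<close> therefore
  yields natural bijections \<open>\<sigma> A i : A i \<rightarrow> \<Phi>(A) i\<close>.  On the free automaton on one input and one
  state, naturality forces \<open>\<sigma>(x * s) = \<sigma>(x)\<^sup>k * \<sigma>(s)\<close> and
  \<open>\<sigma>(x \<circ> s) = \<sigma>(x) \<circ> (\<sigma>(x)\<^sup>m * \<sigma>(s))\<close>, and surjectivity of \<open>\<sigma>\<close> leaves only \<open>k = 1\<close> and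
  \<open>m = 0\<close>.  So \<open>\<sigma>\<close> is an isomorphism, i.e. \<open>\<Phi>\<close> is inner.  Pulling back along \<open>\<sigma>\<close> preserves
  closedness and inverts \<open>\<alpha>\<close>, so both automatons have the same closed relations.
\<close>

section \<open>Homomorphisms from free automatons\<close>

lemma free_hom_eqI:
  assumes "\<phi> \<in> homs (free_automaton X) A" "\<psi> \<in> homs (free_automaton X) A"
    and eq: "\<And>i x. x \<in> X i \<Longrightarrow> \<phi> i (Var x) = \<psi> i (Var x)"
  shows "\<phi> = \<psi>"
proof (intro ext)
  fix i t
  have "\<phi> i t = \<psi> i t" if "(i, t) \<in> terms X"
    using that by induction (use eq assms(1,2) in \<open>auto simp: homs_def\<close>)
  moreover have "\<phi> i \<in> extensional (carrier (free_automaton X) i)"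
    "\<psi> i \<in> extensional (carrier (free_automaton X) i)"
    using assms(1,2) by (auto simp: homs_def PiE_def)
  ultimately show "\<phi> i t = \<psi> i t"
    by (cases "(i, t) \<in> terms X") (auto simp: extensional_def)
qed

lemma comp_hom_apply: "a \<in> carrier A i \<Longrightarrow> comp_hom A g f i a = g i (f i a)"
  by (simp add: comp_hom_def compose_def)

lemma comp_hom_eqD: "comp_hom A g f = h \<Longrightarrow> a \<in> carrier A i \<Longrightarrow> g i (f i a) = h i a"
  using comp_hom_apply by metis

lemma comp_hom_in_homs:
  assumes "is_automaton A" "f \<in> homs A B" "g \<in> homs B C"
  shows "comp_hom A g f \<in> homs A C"
  using assms(1) homsD[OF assms(2)] homsD[OF assms(3)]
  by (auto simp: homs_def comp_hom_def compose_def is_automaton_def)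

lemma id_hom_in_homs: "is_automaton A \<Longrightarrow> id_hom A \<in> homs A A"
  by (auto simp: homs_def id_hom_def is_automaton_def)

lemma homs_carrier_nonempty:
  "\<phi> \<in> homs A B \<Longrightarrow> carrier A i \<noteq> {} \<Longrightarrow> carrier B i \<noteq> {}"
  using homsD(1) by fastforce

definition free_ext ::
  "(gamma \<Rightarrow> 'x set) \<Rightarrow> 'a automaton \<Rightarrow> (gamma \<Rightarrow> 'x \<Rightarrow> 'a) \<Rightarrow> gamma \<Rightarrow> 'x aterm \<Rightarrow> 'a" where
  "free_ext X A f =
     (THE \<phi>. \<phi> \<in> homs (free_automaton X) A \<and> (\<forall>i. \<forall>x\<in>X i. \<phi> i (Var x) = f i x))"

lemma free_ext:
  assumes "is_automaton A" and "\<And>i x. x \<in> X i \<Longrightarrow> f i x \<in> carrier A i"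
  shows free_ext_homs: "free_ext X A f \<in> homs (free_automaton X) A"
    and free_ext_Var: "x \<in> X i \<Longrightarrow> free_ext X A f i (Var x) = f i x"
  using theI'[OF free_automaton_universal[of A f X]] assms unfolding free_ext_def by auto

lemma carrier_free_nonempty: "X i \<noteq> {} \<Longrightarrow> carrier (free_automaton X) i \<noteq> {}"
  by (auto simp: free_automaton_def intro: terms.intros)

lemma homs_free_nonempty:
  assumes "is_automaton A" and "\<And>i. X i \<noteq> {} \<Longrightarrow> carrier A i \<noteq> {}"
  shows "homs (free_automaton X) A \<noteq> {}"
proof -
  have "\<exists>a. X i \<noteq> {} \<longrightarrow> a \<in> carrier A i" for i
    using assms(2)[of i] by blast
  then obtain a where "\<And>i. X i \<noteq> {} \<longrightarrow> a i \<in> carrier A i"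
    by metis
  then show ?thesis
    using free_ext_homs[OF assms(1), of X "\<lambda>i _. a i"] by blast
qed

section \<open>Free automatons on one generator\<close>

definition single :: "gamma \<Rightarrow> 'x \<Rightarrow> gamma \<Rightarrow> 'x set" where
  "single i x = (\<lambda>j. if j = i then {x} else {})"

lemma single_iff [simp]: "z \<in> single i x j \<longleftrightarrow> j = i \<and> z = x"
  by (simp add: single_def)

text \<open>Each operation consumes an input and a state, so one generator alone yields no compound
  term.\<close>

lemma terms_single [simp]: "(j, t) \<in> terms (single i x) \<longleftrightarrow> j = i \<and> t = Var x"
proof
  show "j = i \<and> t = Var x" if "(j, t) \<in> terms (single i x)"
    using that by induction auto
qed (auto intro: terms.intros)

lemma homs_single_eq_iff:
  assumes "\<phi> \<in> homs (free_automaton (single i x)) A" "\<psi> \<in> homs (free_automaton (single i x)) A"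
  shows "\<phi> = \<psi> \<longleftrightarrow> \<phi> i (Var x) = \<psi> i (Var x)"
  using free_hom_eqI[OF assms] by auto

text \<open>This makes nonemptiness of a sort a statement about hom-sets, which a category
  automorphism transports.\<close>

lemma homs_single_nonempty_iff:
  assumes "is_automaton A"
  shows "homs (free_automaton (single i x)) A \<noteq> {} \<longleftrightarrow> carrier A i \<noteq> {}"
  using homs_free_nonempty[OF assms, of "single i x"]
    homs_carrier_nonempty[of _ "free_automaton (single i x)" A i]
  by fastforce

section \<open>Iterated action of one input on a state\<close>

lemma free_hom_funpow:
  assumes \<phi>: "\<phi> \<in> homs (free_automaton X) (free_automaton Y)"
    and "(Input, u) \<in> terms X" "(State, v) \<in> terms X"
  shows "(State, (Star u ^^ n) v) \<in> terms X"
    and "\<phi> State ((Star u ^^ n) v) = (Star (\<phi> Input u) ^^ n) (\<phi> State v)"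
proof (induction n)
  case (Suc n)
  { case 1 then show ?case using Suc assms by (auto intro: terms.intros) next
    case 2 then show ?case using Suc homsD(2)[OF \<phi>, of u] assms by auto }
qed (use assms in auto)

text \<open>Every application of \<open>Star u\<close> enlarges the term by the positive amount
  \<open>Suc (size u)\<close>, so the exponent can be read off from the size. Later this turns
  equations between terms into equations between exponents.\<close>

lemma funpow_Star_eq_iff: "(Star u ^^ m) v = (Star u ^^ n) v \<longleftrightarrow> m = n"
proof -
  have "size ((Star u ^^ n) v) = n * Suc (size u) + size v" for n
    by (induction n) auto
  then show ?thesis
    by (metis add_right_cancel mult_cancel2 nat.distinct(1))
qed

definition pair_gens :: "(gamma \<Rightarrow> 'x) \<Rightarrow> gamma \<Rightarrow> 'x set" where
  "pair_gens e = (\<lambda>j. if j = Output then {} else {e j})"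

text \<open>No operation produces inputs, so the generator is the only input and can merely be
  iterated on the state generator. Without output generators, every output is a \<open>Circ\<close>
  term, so states and outputs are both described by one exponent.\<close>

lemma terms_pair_gens:
  assumes "(i, t) \<in> terms (pair_gens e)"
  shows "(i = Input \<longrightarrow> t = Var (e Input)) \<and>
    (i = State \<longrightarrow> (\<exists>k. t = (Star (Var (e Input)) ^^ k) (Var (e State)))) \<and>
    (i = Output \<longrightarrow> (\<exists>k. t = Circ (Var (e Input)) ((Star (Var (e Input)) ^^ k) (Var (e State)))))"
  using assms
proof induction
  case (Var x i)
  then show ?case
    by (auto simp: pair_gens_def split: if_splits intro: exI[of _ 0])
next
  case (Star u v)
  then obtain k where "u = Var (e Input)" "v = (Star (Var (e Input)) ^^ k) (Var (e State))"
    by auto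
  then show ?case by (auto intro: exI[of _ "Suc k"])
qed auto

section \<open>Algebraically closed relations\<close>

text \<open>Homomorphisms out of a one-generator automaton are determined at the generator. Tested
  on them, the condition on composites in automorphic equivalence becomes membership in the closed
  relation.\<close>

lemma nat_epi_comp_eq_iff:
  assumes A: "is_automaton A" and T: "T \<in> Cl H A"
    and \<mu>: "\<mu> \<in> homs (free_automaton (single i x)) A" and \<nu>: "\<nu> \<in> homs (free_automaton (single i x)) A"
  shows "comp_hom (free_automaton (single i x)) (nat_epi A T) \<mu> =
      comp_hom (free_automaton (single i x)) (nat_epi A T) \<nu> \<longleftrightarrow>
    (\<mu> i (Var x), \<nu> i (Var x)) \<in> T i"
proof -
  have "\<mu> i (Var x) \<in> carrier A i" "\<nu> i (Var x) \<in> carrier A i"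
    using homsD(1)[OF \<mu>, of "Var x" i] homsD(1)[OF \<nu>, of "Var x" i] by auto
  then show ?thesis
    using homs_single_eq_iff[OF comp_hom_in_homs[OF is_automaton_free_automaton \<mu> nat_epi_hom(1)[OF A T]]
        comp_hom_in_homs[OF is_automaton_free_automaton \<nu> nat_epi_hom(1)[OF A T]]]
      eq_equiv_class_iff[OF equiv_Cl[OF T]]
    by (simp add: comp_hom_apply nat_epi_def)
qed

lemma alg_closure_iff:
  "(a, b) \<in> alg_closure H F T i \<longleftrightarrow> a \<in> carrier F i \<and> b \<in> carrier F i \<and>
     (\<forall>\<phi>\<in>homs F H. T \<le> hom_ker F \<phi> \<longrightarrow> \<phi> i a = \<phi> i b)"
  by (auto simp: alg_closure_def full_rel_def hom_ker_def)

lemma alg_closure_le_full: "alg_closure H F T \<le> full_rel F"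
  by (simp add: alg_closure_def)

lemma le_alg_closure: "T \<le> full_rel F \<Longrightarrow> T \<le> alg_closure H F T"
  by (auto simp: alg_closure_def intro!: INF_greatest)

lemma alg_closure_mono: "T \<le> U \<Longrightarrow> alg_closure H F T \<le> alg_closure H F U"
  unfolding alg_closure_def by (intro inf_mono order_refl INF_superset_mono) auto

text \<open>Idempotence: any kernel that contains \<open>T\<close> also contains its closure, so
  closing a second time intersects over at least the same kernels.\<close>

lemma alg_closure_Cl: "alg_closure H F T \<in> Cl H F"
proof -
  have "alg_closure H F T \<le> hom_ker F \<phi>" if "\<phi> \<in> homs F H" "T \<le> hom_ker F \<phi>" for \<phi>
    unfolding alg_closure_def using that by (intro le_infI2 INF_lower) auto
  then have "{\<phi> \<in> homs F H. T \<le> hom_ker F \<phi>} \<subseteq> {\<phi> \<in> homs F H. alg_closure H F T \<le> hom_ker F \<phi>}"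
    by auto
  then have "alg_closure H F (alg_closure H F T) \<le> alg_closure H F T"
    unfolding alg_closure_def[of H F "alg_closure H F T"]
    by (subst (2) alg_closure_def) (intro inf_mono order_refl INF_superset_mono)
  then show ?thesis
    by (simp add: Cl_def alg_closure_le_full antisym[OF _ le_alg_closure[OF alg_closure_le_full]])
qed

lemma alg_closure_least: "U \<in> Cl H F \<Longrightarrow> T \<le> U \<Longrightarrow> alg_closure H F T \<le> U"
  using alg_closure_mono[of T U H F] by (simp add: Cl_def)

text \<open>The closure is the least closed relation above \<open>T\<close>, so the family of closed
  relations determines the closure operator.\<close>

lemma alg_closure_cong:
  assumes "Cl H1 F = Cl H2 F" and T: "T \<le> full_rel F"
  shows "alg_closure H1 F T = alg_closure H2 F T"
proof (rule antisym)
  show "alg_closure H1 F T \<le> alg_closure H2 F T"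
    using alg_closure_Cl[of H2 F T] unfolding assms(1)[symmetric]
    by (rule alg_closure_least) (rule le_alg_closure[OF T])
  show "alg_closure H2 F T \<le> alg_closure H1 F T"
    using alg_closure_Cl[of H1 F T] unfolding assms(1)
    by (rule alg_closure_least) (rule le_alg_closure[OF T])
qed

section \<open>Pulling closed relations back along homomorphisms\<close>

definition pullback ::
  "'a automaton \<Rightarrow> (gamma \<Rightarrow> 'a \<Rightarrow> 'b) \<Rightarrow> (gamma \<Rightarrow> ('b \<times> 'b) set) \<Rightarrow> gamma \<Rightarrow> ('a \<times> 'a) set" where
  "pullback A \<sigma> U = (\<lambda>i. {(a, b). a \<in> carrier A i \<and> b \<in> carrier A i \<and> (\<sigma> i a, \<sigma> i b) \<in> U i})"

text \<open>If the kernel of \<open>\<phi>\<close> on \<open>B\<close> contains \<open>U\<close>,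
  then the kernel of \<open>\<phi>\<close> after \<open>\<sigma>\<close> contains the pullback. A
  pair in the closure of the pullback is therefore sent by \<open>\<sigma>\<close> to a pair
  identified by all such \<open>\<phi>\<close>, that is, to a pair in the closed
  \<open>U\<close>.\<close>

lemma pullback_Cl:
  assumes A: "is_automaton A" and \<sigma>: "\<sigma> \<in> homs A B" and U: "U \<in> Cl H B"
  shows "pullback A \<sigma> U \<in> Cl H A"
proof -
  have full: "pullback A \<sigma> U \<le> full_rel A"
    by (auto simp: pullback_def full_rel_def le_fun_def)
  moreover have "alg_closure H A (pullback A \<sigma> U) \<le> pullback A \<sigma> U"
  proof (intro le_funI subrelI)
    fix i a b assume ab: "(a, b) \<in> alg_closure H A (pullback A \<sigma> U) i"
    then have c: "a \<in> carrier A i" "b \<in> carrier A i"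
      by (auto simp: alg_closure_iff)
    have "\<phi> i (\<sigma> i a) = \<phi> i (\<sigma> i b)" if \<phi>: "\<phi> \<in> homs B H" "U \<le> hom_ker B \<phi>" for \<phi>
    proof -
      have "pullback A \<sigma> U \<le> hom_ker A (comp_hom A \<phi> \<sigma>)"
        using \<phi>(2) by (fastforce simp: pullback_def hom_ker_def le_fun_def comp_hom_apply)
      then show ?thesis
        using ab comp_hom_in_homs[OF A \<sigma> \<phi>(1)] c by (auto simp: alg_closure_iff comp_hom_apply)
    qed
    then show "(a, b) \<in> pullback A \<sigma> U i"
      using c homsD(1)[OF \<sigma>] by (auto simp: pullback_def Cl_iff[OF U])
  qed
  ultimately show ?thesis
    using le_alg_closure[OF full] by (auto simp: Cl_def intro: antisym)
qed

lemma inverse_hom: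
  assumes A: "is_automaton A" and \<sigma>: "\<sigma> \<in> homs A B"
    and bij: "\<And>i. bij_betw (\<sigma> i) (carrier A i) (carrier B i)"
  obtains \<rho> where "\<rho> \<in> homs B A" "\<And>i a. a \<in> carrier A i \<Longrightarrow> \<rho> i (\<sigma> i a) = a"
proof
  define \<rho> where "\<rho> = (\<lambda>i. \<lambda>b\<in>carrier B i. inv_into (carrier A i) (\<sigma> i) b)"
  show left: "\<rho> i (\<sigma> i a) = a" if "a \<in> carrier A i" for i a
    using that homsD(1)[OF \<sigma> that] bij_betw_imp_inj_on[OF bij] by (simp add: \<rho>_def)
  have surj: "\<exists>a\<in>carrier A i. b = \<sigma> i a" if "b \<in> carrier B i" for i b
    using that bij_betw_imp_surj_on[OF bij, of i] by blast
  have "\<rho> i \<in> carrier B i \<rightarrow>\<^sub>E carrier A i" for i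
    using surj left by (fastforce simp: PiE_iff \<rho>_def)
  moreover have "\<rho> State (star B x s) = star A (\<rho> Input x) (\<rho> State s) \<and>
      \<rho> Output (circ B x s) = circ A (\<rho> Input x) (\<rho> State s)"
    if xs: "x \<in> carrier B Input" "s \<in> carrier B State" for x s
  proof -
    obtain a b where ab: "a \<in> carrier A Input" "x = \<sigma> Input a" "b \<in> carrier A State" "s = \<sigma> State b"
      using surj xs by metis
    then have "star B x s = \<sigma> State (star A a b)" "circ B x s = \<sigma> Output (circ A a b)"
      using homsD(2,3)[OF \<sigma>] by simp_all
    then show ?thesis
      using ab A left unfolding is_automaton_def by simp
  qed
  ultimately show "\<rho> \<in> homs B A"
    by (simp add: homs_def)
qed

section \<open>Automorphisms of the category are inner\<close>

abbreviation objs :: "(gamma \<Rightarrow> 'x set) \<Rightarrow> 'x aterm automaton set" where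
  "objs X0 \<equiv> Obj (Theta0 X0)"

lemma objsE:
  assumes "A \<in> objs X0"
  obtains X where "A = free_automaton X"
  using assms by (auto simp: Theta0_def)

lemma free_in_objs: "(\<And>i. X i \<subseteq> X0 i) \<Longrightarrow> (\<And>i. finite (X i)) \<Longrightarrow> free_automaton X \<in> objs X0"
  by (auto simp: Theta0_def)

lemma objs_is_automaton: "A \<in> objs X0 \<Longrightarrow> is_automaton A"
  by (auto elim: objsE intro: is_automaton_free_automaton)

text \<open>The inverse functor enters through \<open>omap_surj\<close> and the bijections on
  hom-sets; \<open>e\<close> fixes one generator of each sort.\<close>

locale theta0_automorphism =
  fixes X0 :: "gamma \<Rightarrow> 'x set" and e :: "gamma \<Rightarrow> 'x"
    and \<Phi> :: "('x aterm automaton, gamma \<Rightarrow> 'x aterm \<Rightarrow> 'x aterm,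
               'x aterm automaton, gamma \<Rightarrow> 'x aterm \<Rightarrow> 'x aterm) cfunctor"
  assumes e: "e i \<in> X0 i"
    and omap_objs: "A \<in> objs X0 \<Longrightarrow> omap \<Phi> A \<in> objs X0"
    and omap_surj: "B \<in> objs X0 \<Longrightarrow> \<exists>A\<in>objs X0. B = omap \<Phi> A"
    and mmap_bij: "A \<in> objs X0 \<Longrightarrow> B \<in> objs X0 \<Longrightarrow>
        bij_betw (mmap \<Phi> A B) (homs A B) (homs (omap \<Phi> A) (omap \<Phi> B))"
    and mmap_id: "A \<in> objs X0 \<Longrightarrow> mmap \<Phi> A A (id_hom A) = id_hom (omap \<Phi> A)"
    and mmap_comp: "A \<in> objs X0 \<Longrightarrow> B \<in> objs X0 \<Longrightarrow> C \<in> objs X0 \<Longrightarrow>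
        f \<in> homs A B \<Longrightarrow> g \<in> homs B C \<Longrightarrow>
        mmap \<Phi> A C (comp_hom A g f) =
        comp_hom (omap \<Phi> A) (mmap \<Phi> B C g) (mmap \<Phi> A B f)"
begin

abbreviation sg :: "gamma \<Rightarrow> 'x aterm automaton" where
  "sg i \<equiv> free_automaton (single i (e i))"

abbreviation fpair :: "'x aterm automaton" where
  "fpair \<equiv> free_automaton (pair_gens e)"

lemma sg_objs: "sg i \<in> objs X0"
  using e by (auto intro!: free_in_objs simp: single_def split: if_splits)

lemma fpair_objs: "fpair \<in> objs X0"
  using e by (auto intro!: free_in_objs simp: pair_gens_def split: if_splits)

lemma fpair_gens [simp]:
  "(Input, Var (e Input)) \<in> terms (pair_gens e)"
  "(State, Var (e State)) \<in> terms (pair_gens e)"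
  by (auto simp: pair_gens_def intro!: terms.intros)

lemma mmap_homs:
  "A \<in> objs X0 \<Longrightarrow> B \<in> objs X0 \<Longrightarrow> \<mu> \<in> homs A B \<Longrightarrow> mmap \<Phi> A B \<mu> \<in> homs (omap \<Phi> A) (omap \<Phi> B)"
  using mmap_bij bij_betwE by blast

lemma mmap_eq_iff:
  "A \<in> objs X0 \<Longrightarrow> B \<in> objs X0 \<Longrightarrow> \<mu> \<in> homs A B \<Longrightarrow> \<nu> \<in> homs A B \<Longrightarrow>
     mmap \<Phi> A B \<mu> = mmap \<Phi> A B \<nu> \<longleftrightarrow> \<mu> = \<nu>"
  using mmap_bij bij_betw_imp_inj_on inj_on_eq_iff by metis

lemma mmap_surj:
  assumes "A \<in> objs X0" "B \<in> objs X0" "\<psi> \<in> homs (omap \<Phi> A) (omap \<Phi> B)"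
  obtains \<mu> where "\<mu> \<in> homs A B" "\<psi> = mmap \<Phi> A B \<mu>"
  using mmap_bij[OF assms(1,2)] assms(3) by (auto simp: bij_betw_def)

lemma homs_omap_nonempty_iff:
  assumes "A \<in> objs X0" "B \<in> objs X0"
  shows "homs (omap \<Phi> A) (omap \<Phi> B) \<noteq> {} \<longleftrightarrow> homs A B \<noteq> {}"
  using mmap_bij[OF assms] by (auto simp: bij_betw_def)

section \<open>Images of the one-generator free automatons\<close>

lemma omap_no_gens:
  assumes "A \<in> objs X0" and "omap \<Phi> A = free_automaton Y" and "B \<in> objs X0" and "\<And>i. Y i = {}"
  shows "homs A B \<noteq> {}"
  using homs_omap_nonempty_iff[of A B] assms
    homs_free_nonempty[OF objs_is_automaton[OF omap_objs[OF assms(3)]], of Y]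
  by auto

text \<open>The empty map extends to a homomorphism into any automaton, so an object without
  generators maps to every object. This lemma and \<open>omap_no_gens\<close> carry that property
  across \<Phi> in the two directions; combined with \<open>not_all_homs_sg\<close> they force
  generators to exist.\<close>

lemma no_gens_omap:
  assumes "A \<in> objs X0" "A = free_automaton X" "B \<in> objs X0" "\<And>i. X i = {}"
  shows "homs (omap \<Phi> A) B \<noteq> {}"
proof -
  obtain B' where B': "B' \<in> objs X0" "B = omap \<Phi> B'"
    using omap_surj assms(3) by blast
  then show ?thesis
    using homs_omap_nonempty_iff[of A B'] homs_free_nonempty[OF objs_is_automaton[OF B'(1)], of X] assms
    by auto
qed

lemma not_all_homs_sg: "\<exists>j. homs (sg i) (sg j) = {}"
proof -
  obtain j where "j \<noteq> i" by (cases i) auto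
  then have "carrier (sg j) i = {}" by auto
  then have "homs (sg i) (sg j) = {}"
    using homs_single_nonempty_iff[OF is_automaton_free_automaton, of i "e i"] by metis
  then show ?thesis ..
qed

text \<open>Existence of homomorphisms restricts the generators of the image to one sort. Within
  that sort there is only one, because \<open>sg i\<close> has no endomorphism besides the identity
  while several generators could be collapsed.\<close>

lemma omap_sg_single: "\<exists>j y. omap \<Phi> (sg i) = free_automaton (single j y)"
proof -
  obtain Y where Y: "omap \<Phi> (sg i) = free_automaton Y"
    using omap_objs[OF sg_objs] objsE by metis
  obtain j where j: "Y j \<noteq> {}"
    using omap_no_gens[OF sg_objs Y] not_all_homs_sg sg_objs by metis
  \<comment> \<open>The preimage \<open>G\<close> of \<open>sg j\<close> allows hom-sets around
    \<open>sg j\<close> to be compared with hom-sets around \<open>sg i\<close>.\<close>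
  obtain G where G: "G \<in> objs X0" "sg j = omap \<Phi> G"
    using omap_surj sg_objs by blast
  obtain Z where Z: "G = free_automaton Z"
    using G(1) objsE by metis
  have "homs (sg j) (omap \<Phi> (sg i)) \<noteq> {}"
    using j unfolding Y homs_single_nonempty_iff[OF is_automaton_free_automaton]
    by (rule carrier_free_nonempty)
  then have GI: "homs G (sg i) \<noteq> {}"
    using homs_omap_nonempty_iff[OF G(1) sg_objs] G(2) by simp
  obtain k where k: "Z k \<noteq> {}"
    using no_gens_omap[OF G(1) Z] not_all_homs_sg[of j] sg_objs unfolding G(2)[symmetric] by metis
  then have ck: "carrier G k \<noteq> {}"
    unfolding Z by (rule carrier_free_nonempty)
  then have "carrier (sg i) k \<noteq> {}"
    using GI homs_carrier_nonempty by blast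
  \<comment> \<open>\<open>sg i\<close> is empty in all other sorts, yet receives a homomorphism
    from \<open>G\<close>. Hence \<open>G\<close> has elements of sort \<open>i\<close>, which gives
    a homomorphism from \<open>sg i\<close> back to \<open>G\<close>; its image under \<Phi> goes
    from \<open>free_automaton Y\<close> to \<open>sg j\<close>.\<close>
  then have "k = i" by auto
  then have "homs (sg i) G \<noteq> {}"
    using ck unfolding homs_single_nonempty_iff[OF objs_is_automaton[OF G(1)]] by simp
  then have "homs (free_automaton Y) (sg j) \<noteq> {}"
    unfolding G(2) Y[symmetric] by (rule iffD2[OF homs_omap_nonempty_iff[OF sg_objs G(1)]])
  then have only_j: "Y k = {}" if "k \<noteq> j" for k
  proof -
    have "carrier (sg j) k = {}" using that by auto
    then show ?thesis
      using homs_carrier_nonempty[of _ "free_automaton Y" "sg j" k] carrier_free_nonempty[of Y k]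
        \<open>homs (free_automaton Y) (sg j) \<noteq> {}\<close>
      by blast
  qed
  obtain y where y: "y \<in> Y j" using j by blast
  have "z = y" if "z \<in> Y j" for z
  proof -
    \<comment> \<open>The endomorphism that collapses all generators to \<open>y\<close>. It comes
      from an endomorphism of \<open>sg i\<close>, so it must be the identity.\<close>
    let ?c = "free_ext Y (free_automaton Y) (\<lambda>_ _. Var y)"
    have gen: "Var y \<in> carrier (free_automaton Y) l" if "x \<in> Y l" for l x
      using only_j y that by (cases "l = j") (auto intro: terms.intros)
    have c: "?c \<in> homs (free_automaton Y) (free_automaton Y)" "?c j (Var z) = Var y"
      using free_ext[OF is_automaton_free_automaton, of Y "\<lambda>_ _. Var y", OF gen] that by auto
    obtain \<mu> where \<mu>: "\<mu> \<in> homs (sg i) (sg i)" "?c = mmap \<Phi> (sg i) (sg i) \<mu>"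
      using mmap_surj[OF sg_objs[of i] sg_objs[of i], unfolded Y, OF c(1)] by blast
    have "\<mu> i (Var (e i)) = id_hom (sg i) i (Var (e i))"
      using homsD(1)[OF \<mu>(1), of "Var (e i)" i] by (simp add: id_hom_def)
    then have "\<mu> = id_hom (sg i)"
      using homs_single_eq_iff[OF \<mu>(1) id_hom_in_homs[OF is_automaton_free_automaton]] by simp
    then have "?c = id_hom (free_automaton Y)"
      using \<mu>(2) mmap_id[OF sg_objs] Y by simp
    then show ?thesis
      using c(2) that by (auto simp: id_hom_def terms.intros)
  qed
  then have "Y j = {y}" using y by blast
  then have "Y = single j y"
    using only_j unfolding single_def by metis
  then show ?thesis using Y by blast
qed

text \<open>By \<open>omap_sg_single\<close>, \<Phi> acts on sorts by a map \<pi>, and sort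
  \<open>i\<close> of \<open>A\<close> is nonempty exactly when sort \<open>\<pi> i\<close> of the
  image is. Testing this on the \<open>sg j\<close> makes \<pi> injective; the different roles of
  the sorts in the operations then exclude all permutations but the identity.\<close>

lemma omap_sg: "\<exists>y. omap \<Phi> (sg i) = free_automaton (single i y)"
proof -
  obtain \<pi> y where \<pi>: "\<And>i. omap \<Phi> (sg i) = free_automaton (single (\<pi> i) (y i))"
    using omap_sg_single by metis
  have ne: "carrier (omap \<Phi> A) (\<pi> i) \<noteq> {} \<longleftrightarrow> carrier A i \<noteq> {}" if "A \<in> objs X0" for A i
    using homs_omap_nonempty_iff[OF sg_objs that, of i]
    unfolding \<pi> homs_single_nonempty_iff[OF objs_is_automaton[OF that]]
      homs_single_nonempty_iff[OF objs_is_automaton[OF omap_objs[OF that]]] .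
  have inj: "i = j" if "\<pi> i = \<pi> j" for i j
    using ne[OF sg_objs, of j i] ne[OF sg_objs, of j j] that by auto
  have carrier_out: "carrier (omap \<Phi> A) Output \<noteq> {}"
    if "A \<in> objs X0" "carrier (omap \<Phi> A) Input \<noteq> {}" "carrier (omap \<Phi> A) State \<noteq> {}" for A
    using objs_is_automaton[OF omap_objs[OF that(1)]] that unfolding is_automaton_def by blast
  have "\<pi> Input = Input"
  proof (rule ccontr)
    \<comment> \<open>\<open>sg Input\<close> has just one homomorphism to \<open>fpair\<close>, but an automaton with inputs and states
      has at least two elements both of sort \<open>State\<close> and of sort \<open>Output\<close>.\<close>
    assume neq: "\<pi> Input \<noteq> Input"
    obtain Y where Y: "omap \<Phi> fpair = free_automaton Y"
      using omap_objs[OF fpair_objs] objsE by metis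
    have "Circ (Var (e Input)) (Var (e State)) \<in> carrier fpair Output"
      by (auto intro: terms.intros)
    then have all: "carrier fpair i \<noteq> {}" for i
      by (cases i) (use fpair_gens in \<open>auto simp del: fpair_gens\<close>)
    have "\<exists>i. \<pi> i = j" for j
    proof -
      have "inj \<pi>" using inj by (auto simp: inj_def)
      moreover have "finite (UNIV :: gamma set)"
      proof -
        have "(UNIV :: gamma set) = {Input, State, Output}"
          using gamma.exhaust by auto
        then show ?thesis by (metis finite.emptyI finite.insertI)
      qed
      ultimately have "surj \<pi>" by (simp add: finite_UNIV_inj_surj)
      then show ?thesis by (metis surjD)
    qed
    then have "carrier (free_automaton Y) j \<noteq> {}" for j
      using all ne[OF fpair_objs] Y by metis
    then obtain u v where uv: "(Input, u) \<in> terms Y" "(State, v) \<in> terms Y"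
      by fastforce
    have "\<exists>a b. a \<noteq> b \<and> (\<pi> Input, a) \<in> terms Y \<and> (\<pi> Input, b) \<in> terms Y"
    proof (cases "\<pi> Input")
      case State
      have "v \<noteq> Star u v" using funpow_Star_eq_iff[of 0 u v 1] by simp
      then show ?thesis using uv State by (metis terms.Star)
    next
      case Output
      have "Circ u v \<noteq> Circ u (Star u v)" using funpow_Star_eq_iff[of 0 u v 1] by simp
      then show ?thesis using uv Output by (metis terms.Star terms.Circ)
    qed (use neq in simp)
    then obtain a b where ab: "a \<noteq> b" "a \<in> carrier (omap \<Phi> fpair) (\<pi> Input)"
        "b \<in> carrier (omap \<Phi> fpair) (\<pi> Input)"
      by (auto simp: Y)
    let ?h = "\<lambda>c. free_ext (single (\<pi> Input) (y Input)) (omap \<Phi> fpair) (\<lambda>_ _. c)"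
    have h: "?h c \<in> homs (omap \<Phi> (sg Input)) (omap \<Phi> fpair)"
        "?h c (\<pi> Input) (Var (y Input)) = c"
      if "c \<in> carrier (omap \<Phi> fpair) (\<pi> Input)" for c
      using that free_ext[OF objs_is_automaton[OF omap_objs[OF fpair_objs]],
          of "single (\<pi> Input) (y Input)" "\<lambda>_ _. c"]
      by (auto simp: \<pi>)
    obtain \<mu> \<nu> where \<mu>: "\<mu> \<in> homs (sg Input) fpair" "?h a = mmap \<Phi> (sg Input) fpair \<mu>"
      and \<nu>: "\<nu> \<in> homs (sg Input) fpair" "?h b = mmap \<Phi> (sg Input) fpair \<nu>"
      using h(1) ab mmap_surj[OF sg_objs fpair_objs] by metis
    have "\<mu> = \<nu>"
      using homs_single_eq_iff[OF \<mu>(1) \<nu>(1)] homsD(1)[OF \<mu>(1), of "Var (e Input)" Input]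
        homsD(1)[OF \<nu>(1), of "Var (e Input)" Input]
        terms_pair_gens[of Input "\<mu> Input (Var (e Input))" e]
        terms_pair_gens[of Input "\<nu> Input (Var (e Input))" e]
      by simp
    then show False
      using \<mu>(2) \<nu>(2) h(2) ab by metis
  qed
  moreover have "\<pi> State \<noteq> Output"
  proof
    \<comment> \<open>The automaton on one input and one output has no states; its image would have inputs and
      states but no outputs.\<close>
    assume so: "\<pi> State = Output"
    then have os: "\<pi> Output = State"
      using inj[of Output State] inj[of Output Input] \<open>\<pi> Input = Input\<close>
      by (cases "\<pi> Output") auto
    let ?X = "\<lambda>i. if i = State then {} else {e i}"
    let ?B = "free_automaton ?X"
    have B: "?B \<in> objs X0"
      using e by (auto intro!: free_in_objs split: if_splits)
    have no: "i \<noteq> State" if "(i, t) \<in> terms ?X" for i t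
      using that by induction (auto split: if_splits)
    have "carrier ?B State = {}"
      using no[of State] by auto
    moreover have "Var (e Input) \<in> carrier ?B Input" "Var (e Output) \<in> carrier ?B Output"
      by (auto intro: terms.intros)
    ultimately show False
      using ne[OF B, of State] ne[OF B, of Input] ne[OF B, of Output] carrier_out[OF B]
        so os \<open>\<pi> Input = Input\<close> by auto
  qed
  ultimately have "\<pi> i = i"
    using inj[of State Input] inj[of Output Input] inj[of Output State]
    by (cases i; cases "\<pi> i"; cases "\<pi> State") auto
  then show ?thesis using \<pi>[of i] by auto
qed

section \<open>Natural bijections between the sorts of an object and of its image\<close>

definition gen :: "gamma \<Rightarrow> 'x" where
  "gen i = (SOME z. omap \<Phi> (sg i) = free_automaton (single i z))"

lemma omap_sg_eq: "omap \<Phi> (sg i) = free_automaton (single i (gen i))"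
  unfolding gen_def by (rule someI_ex) (rule omap_sg)

definition point_hom :: "'x aterm automaton \<Rightarrow> gamma \<Rightarrow> 'x aterm \<Rightarrow> gamma \<Rightarrow> 'x aterm \<Rightarrow> 'x aterm" where
  "point_hom A i a = free_ext (single i (e i)) A (\<lambda>_ _. a)"

lemma point_hom:
  assumes "A \<in> objs X0" "a \<in> carrier A i"
  shows point_hom_homs: "point_hom A i a \<in> homs (sg i) A" and point_hom_Var: "point_hom A i a i (Var (e i)) = a"
  using free_ext[OF objs_is_automaton[OF assms(1)], of "single i (e i)" "\<lambda>_ _. a"] assms(2)
  by (auto simp: point_hom_def)

text \<open>A Yoneda-style transport: \<open>sg i\<close> represents sort \<open>i\<close>, and its
  image represents the same sort through the possibly renamed generator
  \<open>gen i\<close>.\<close>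

definition \<sigma> :: "'x aterm automaton \<Rightarrow> gamma \<Rightarrow> 'x aterm \<Rightarrow> 'x aterm" where
  "\<sigma> A i = (\<lambda>a\<in>carrier A i. mmap \<Phi> (sg i) A (point_hom A i a) i (Var (gen i)))"

lemma mmap_point_homs:
  assumes "A \<in> objs X0" "a \<in> carrier A i"
  shows "mmap \<Phi> (sg i) A (point_hom A i a) \<in> homs (free_automaton (single i (gen i))) (omap \<Phi> A)"
  using mmap_homs[OF sg_objs assms(1) point_hom_homs[OF assms]] by (simp add: omap_sg_eq)

lemma \<sigma>_carrier:
  assumes "A \<in> objs X0" "a \<in> carrier A i"
  shows "\<sigma> A i a \<in> carrier (omap \<Phi> A) i"
  using homsD(1)[OF mmap_point_homs[OF assms], of "Var (gen i)" i] assms(2) by (simp add: \<sigma>_def)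

text \<open>Following the homomorphism that hits \<open>a\<close> by \<mu> gives the one that hits
  \<open>\<mu> i a\<close>; functoriality turns this into naturality.\<close>

lemma \<sigma>_natural:
  assumes A: "A \<in> objs X0" and B: "B \<in> objs X0" and \<mu>: "\<mu> \<in> homs A B" and a: "a \<in> carrier A i"
  shows "mmap \<Phi> A B \<mu> i (\<sigma> A i a) = \<sigma> B i (\<mu> i a)"
proof -
  note \<mu>a = homsD(1)[OF \<mu> a]
  have "comp_hom (sg i) \<mu> (point_hom A i a) = point_hom B i (\<mu> i a)"
    using comp_hom_in_homs[OF is_automaton_free_automaton point_hom_homs[OF A a] \<mu>] point_hom[OF B \<mu>a]
      point_hom_Var[OF A a]
    by (subst homs_single_eq_iff) (auto simp: comp_hom_apply)
  then have "mmap \<Phi> (sg i) B (point_hom B i (\<mu> i a)) =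
      comp_hom (omap \<Phi> (sg i)) (mmap \<Phi> A B \<mu>) (mmap \<Phi> (sg i) A (point_hom A i a))"
    using mmap_comp[OF sg_objs A B point_hom_homs[OF A a] \<mu>] by simp
  then show ?thesis
    using a \<mu>a by (simp add: \<sigma>_def omap_sg_eq comp_hom_apply)
qed

text \<open>This is bijectivity of \<Phi> on homomorphisms from \<open>sg i\<close> to
  \<open>A\<close>, read at the generators. The preimage of \<open>c\<close> is the value at
  \<open>Var (e i)\<close> of the homomorphism whose image hits \<open>c\<close>.\<close>

lemma \<sigma>_bij:
  assumes A: "A \<in> objs X0"
  shows "bij_betw (\<sigma> A i) (carrier A i) (carrier (omap \<Phi> A) i)"
proof (rule bij_betwI')
  fix a b assume ab: "a \<in> carrier A i" "b \<in> carrier A i"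
  have "\<sigma> A i a = \<sigma> A i b \<longleftrightarrow> point_hom A i a = point_hom A i b"
    using ab homs_single_eq_iff[OF mmap_point_homs[OF A ab(1)] mmap_point_homs[OF A ab(2)]]
      mmap_eq_iff[OF sg_objs A point_hom_homs[OF A ab(1)] point_hom_homs[OF A ab(2)]]
    by (simp add: \<sigma>_def)
  then show "\<sigma> A i a = \<sigma> A i b \<longleftrightarrow> a = b"
    using point_hom_Var[OF A ab(1)] point_hom_Var[OF A ab(2)] by metis
next
  fix c assume c: "c \<in> carrier (omap \<Phi> A) i"
  let ?\<psi> = "free_ext (single i (gen i)) (omap \<Phi> A) (\<lambda>_ _. c)"
  have \<psi>: "?\<psi> \<in> homs (omap \<Phi> (sg i)) (omap \<Phi> A)" "?\<psi> i (Var (gen i)) = c"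
    using free_ext[OF objs_is_automaton[OF omap_objs[OF A]], of "single i (gen i)" "\<lambda>_ _. c"] c
    by (auto simp: omap_sg_eq)
  obtain \<mu> where \<mu>: "\<mu> \<in> homs (sg i) A" "?\<psi> = mmap \<Phi> (sg i) A \<mu>"
    using mmap_surj[OF sg_objs A \<psi>(1)] by blast
  have a: "\<mu> i (Var (e i)) \<in> carrier A i"
    using homsD(1)[OF \<mu>(1)] by simp
  then have "point_hom A i (\<mu> i (Var (e i))) = \<mu>"
    using homs_single_eq_iff[OF _ \<mu>(1)] point_hom[OF A a] by simp
  then have "c = \<sigma> A i (\<mu> i (Var (e i)))"
    using \<mu>(2) \<psi>(2) a by (simp add: \<sigma>_def)
  then show "\<exists>a\<in>carrier A i. c = \<sigma> A i a"
    using a by blast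
qed (rule \<sigma>_carrier[OF A])

lemma \<sigma>_inj: "A \<in> objs X0 \<Longrightarrow> a \<in> carrier A i \<Longrightarrow> b \<in> carrier A i \<Longrightarrow> \<sigma> A i a = \<sigma> A i b \<Longrightarrow> a = b"
  using bij_betw_imp_inj_on[OF \<sigma>_bij] by (auto dest: inj_onD)

lemma \<sigma>_surj:
  assumes "A \<in> objs X0" "c \<in> carrier (omap \<Phi> A) i"
  obtains a where "a \<in> carrier A i" "c = \<sigma> A i a"
  using bij_betw_imp_surj_on[OF \<sigma>_bij[OF assms(1)]] assms(2) by blast

section \<open>Compatibility of the bijections with the operations\<close>

definition pair_hom :: "'x aterm automaton \<Rightarrow> 'x aterm \<Rightarrow> 'x aterm \<Rightarrow> gamma \<Rightarrow> 'x aterm \<Rightarrow> 'x aterm" where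
  "pair_hom A u v = free_ext (pair_gens e) A (\<lambda>i _. if i = Input then u else v)"

lemma pair_hom:
  assumes "A \<in> objs X0" "u \<in> carrier A Input" "v \<in> carrier A State"
  shows pair_hom_homs: "pair_hom A u v \<in> homs fpair A"
    and pair_hom_Input: "pair_hom A u v Input (Var (e Input)) = u"
    and pair_hom_State: "pair_hom A u v State (Var (e State)) = v"
proof -
  have "(if i = Input then u else v) \<in> carrier A i" if "x \<in> pair_gens e i" for i x
    using that assms(2,3) by (cases i) (auto simp: pair_gens_def)
  note f = free_ext[OF objs_is_automaton[OF assms(1)], of "pair_gens e", OF this, folded pair_hom_def]
  show "pair_hom A u v \<in> homs fpair A" by (rule f(1))
  show "pair_hom A u v Input (Var (e Input)) = u" "pair_hom A u v State (Var (e State)) = v"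
    using f(2)[where i = Input and x = "e Input"] f(2)[where i = State and x = "e State"] by (auto simp: pair_gens_def)
qed

lemma homs_fpair_eqI:
  assumes "\<phi> \<in> homs fpair A" "\<psi> \<in> homs fpair A"
    and "\<phi> Input (Var (e Input)) = \<psi> Input (Var (e Input))"
    and "\<phi> State (Var (e State)) = \<psi> State (Var (e State))"
  shows "\<phi> = \<psi>"
proof (rule free_hom_eqI[OF assms(1,2)])
  show "\<phi> i (Var x) = \<psi> i (Var x)" if "x \<in> pair_gens e i" for i x
    using that assms(3,4) by (cases i) (auto simp: pair_gens_def)
qed

abbreviation p :: "'x aterm" where "p \<equiv> \<sigma> fpair Input (Var (e Input))"
abbreviation q :: "'x aterm" where "q \<equiv> \<sigma> fpair State (Var (e State))"

lemma pq: "p \<in> carrier (omap \<Phi> fpair) Input" "q \<in> carrier (omap \<Phi> fpair) State"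
  by (auto intro!: \<sigma>_carrier fpair_objs)

text \<open>The elements \<open>p\<close> and \<open>q\<close> generate the image of
  \<open>fpair\<close>. The homomorphism sending the generators of \<open>fpair\<close> to them is
  the image of some \<mu> from \<open>G\<close> to \<open>fpair\<close>, where \<open>fpair\<close>
  is the image of \<open>G\<close>. A section of \<mu> is built below, and its image under \<Phi> is
  a section of that homomorphism.\<close>

lemma pair_hom_surj:
  assumes c: "c \<in> carrier (omap \<Phi> fpair) i"
  obtains t where "t \<in> carrier fpair i" "c = pair_hom (omap \<Phi> fpair) p q i t"
proof -
  let ?h = "pair_hom (omap \<Phi> fpair) p q"
  note h = pair_hom[OF omap_objs[OF fpair_objs] pq]
  obtain G where G: "G \<in> objs X0" "fpair = omap \<Phi> G"
    using omap_surj fpair_objs by blast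
  obtain \<mu> where \<mu>: "\<mu> \<in> homs G fpair" "?h = mmap \<Phi> G fpair \<mu>"
    using mmap_surj[OF G(1) fpair_objs] h(1) unfolding G(2)[symmetric] by blast
  obtain a where a: "a \<in> carrier G Input" "Var (e Input) = \<sigma> G Input a"
    using \<sigma>_surj[OF G(1)] fpair_gens(1) unfolding G(2)[symmetric] by (metis free_automaton_simps(1))
  obtain b where b: "b \<in> carrier G State" "Var (e State) = \<sigma> G State b"
    using \<sigma>_surj[OF G(1)] fpair_gens(2) unfolding G(2)[symmetric] by (metis free_automaton_simps(1))
  have "p = \<sigma> fpair Input (\<mu> Input a)" "q = \<sigma> fpair State (\<mu> State b)"
    using \<sigma>_natural[OF G(1) fpair_objs \<mu>(1) a(1)] \<sigma>_natural[OF G(1) fpair_objs \<mu>(1) b(1)]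
      a(2) b(2) h(2,3) \<mu>(2) by simp_all
  \<comment> \<open>The generators of \<open>fpair\<close> correspond under
    \<open>\<sigma> G\<close> to \<open>a\<close> and \<open>b\<close>, and naturality with
    injectivity shows that \<mu> sends these to the generators again. So
    \<open>pair_hom G a b\<close> is a section of \<mu>.\<close>
  then have ab: "\<mu> Input a = Var (e Input)" "\<mu> State b = Var (e State)"
    using \<sigma>_inj[OF fpair_objs] homsD(1)[OF \<mu>(1)] a(1) b(1) by (metis fpair_gens free_automaton_simps(1))+
  note \<nu> = pair_hom[OF G(1) a(1) b(1)]
  have "comp_hom fpair \<mu> (pair_hom G a b) = id_hom fpair"
    by (rule homs_fpair_eqI)
      (use comp_hom_in_homs[OF is_automaton_free_automaton \<nu>(1) \<mu>(1)] \<nu>(2,3) ab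
        id_hom_in_homs[OF is_automaton_free_automaton] in \<open>auto simp: comp_hom_apply id_hom_def\<close>)
  then have "comp_hom (omap \<Phi> fpair) ?h (mmap \<Phi> fpair G (pair_hom G a b)) = id_hom (omap \<Phi> fpair)"
    using mmap_comp[OF fpair_objs G(1) fpair_objs \<nu>(1) \<mu>(1)] mmap_id[OF fpair_objs] \<mu>(2) by simp
  then have "?h i (mmap \<Phi> fpair G (pair_hom G a b) i c) = c"
    using c by (simp add: comp_hom_eqD id_hom_def)
  moreover have "mmap \<Phi> fpair G (pair_hom G a b) i c \<in> carrier fpair i"
    using homsD(1)[OF mmap_homs[OF fpair_objs G(1) \<nu>(1)] c] G(2) by simp
  ultimately show ?thesis
    using that by metis
qed

text \<open>The pair of generators of \<open>fpair\<close> is generic: a term \<open>t\<close> in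
  \<open>p\<close> and \<open>q\<close> expressing \<open>\<sigma> fpair i s\<close> gives, by
  naturality along \<open>pair_hom B b1 b2\<close>, the same formula for arbitrary \<open>b1\<close>
  and \<open>b2\<close>.\<close>

lemma \<sigma>_pair_hom:
  assumes B: "B \<in> objs X0" and b: "b1 \<in> carrier B Input" "b2 \<in> carrier B State"
    and t: "t \<in> carrier fpair i" and s: "s \<in> carrier fpair i"
    and eq: "\<sigma> fpair i s = pair_hom (omap \<Phi> fpair) p q i t"
  shows "\<sigma> B i (pair_hom B b1 b2 i s) = pair_hom (omap \<Phi> B) (\<sigma> B Input b1) (\<sigma> B State b2) i t"
proof -
  note \<mu> = pair_hom[OF B b] and h = pair_hom[OF omap_objs[OF fpair_objs] pq]
  note \<mu>' = mmap_homs[OF fpair_objs B \<mu>(1)]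
  have "comp_hom fpair (mmap \<Phi> fpair B (pair_hom B b1 b2)) (pair_hom (omap \<Phi> fpair) p q) =
      pair_hom (omap \<Phi> B) (\<sigma> B Input b1) (\<sigma> B State b2)"
    using \<sigma>_natural[OF fpair_objs B \<mu>(1), of _ Input] \<sigma>_natural[OF fpair_objs B \<mu>(1), of _ State] h \<mu>
      pair_hom[OF omap_objs[OF B] \<sigma>_carrier[OF B b(1)] \<sigma>_carrier[OF B b(2)]]
    by (intro homs_fpair_eqI)
      (auto simp: comp_hom_apply intro!: comp_hom_in_homs[OF is_automaton_free_automaton _ \<mu>'])
  then have "mmap \<Phi> fpair B (pair_hom B b1 b2) i (pair_hom (omap \<Phi> fpair) p q i t) =
      pair_hom (omap \<Phi> B) (\<sigma> B Input b1) (\<sigma> B State b2) i t"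
    using t by (rule comp_hom_eqD)
  then show ?thesis
    using \<sigma>_natural[OF fpair_objs B \<mu>(1) s] eq by simp
qed

lemma pair_hom_funpow:
  assumes "B \<in> objs X0" "b1 \<in> carrier B Input" "b2 \<in> carrier B State"
  shows "pair_hom B b1 b2 State ((Star (Var (e Input)) ^^ n) (Var (e State))) = (Star b1 ^^ n) b2"
    and "pair_hom B b1 b2 Output (Circ (Var (e Input)) ((Star (Var (e Input)) ^^ n) (Var (e State)))) =
      Circ b1 ((Star b1 ^^ n) b2)"
proof -
  obtain Y where Y: "B = free_automaton Y" using assms(1) objsE by metis
  note \<phi> = pair_hom[OF assms]
  note f = free_hom_funpow[OF \<phi>(1)[unfolded Y] fpair_gens, of n]
  show 1: "pair_hom B b1 b2 State ((Star (Var (e Input)) ^^ n) (Var (e State))) = (Star b1 ^^ n) b2"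
    using f(2) \<phi>(2,3) by (simp add: Y)
  show "pair_hom B b1 b2 Output (Circ (Var (e Input)) ((Star (Var (e Input)) ^^ n) (Var (e State)))) =
      Circ b1 ((Star b1 ^^ n) b2)"
    using homsD(3)[OF \<phi>(1), of "Var (e Input)" "(Star (Var (e Input)) ^^ n) (Var (e State))"]
      f(1) 1 \<phi>(2) by (simp add: Y)
qed

lemma funpow_carrier:
  assumes "B \<in> objs X0" "b1 \<in> carrier B Input" "b2 \<in> carrier B State"
  shows "(Star b1 ^^ n) b2 \<in> carrier B State"
  using assms by (induction n) (auto elim!: objsE intro: terms.intros)

lemma \<sigma>_Star:
  assumes B: "B \<in> objs X0" and b: "b1 \<in> carrier B Input" "b2 \<in> carrier B State"
  shows "\<sigma> B State (Star b1 b2) = Star (\<sigma> B Input b1) (\<sigma> B State b2)"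
proof -
  let ?x = "Var (e Input)" and ?s = "Var (e State)"
  have xs: "Star ?x ?s \<in> carrier fpair State" by (auto intro: terms.intros)
  obtain t where t: "t \<in> carrier fpair State"
      "\<sigma> fpair State (Star ?x ?s) = pair_hom (omap \<Phi> fpair) p q State t"
    using pair_hom_surj[OF \<sigma>_carrier[OF fpair_objs xs]] by metis
  then obtain k where k: "t = (Star ?x ^^ k) ?s"
    using terms_pair_gens[of State t] by auto
  \<comment> \<open>The exponent \<open>k\<close> is read off once in \<open>fpair\<close> and is
    the same for all objects and arguments.\<close>
  have star: "\<sigma> B State (Star b1 b2) = (Star (\<sigma> B Input b1) ^^ k) (\<sigma> B State b2)"
    if "B \<in> objs X0" "b1 \<in> carrier B Input" "b2 \<in> carrier B State" for B b1 b2
    using \<sigma>_pair_hom[OF that t(1) xs t(2)] pair_hom_funpow(1)[OF that, of 1]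
      pair_hom_funpow(1)[OF omap_objs[OF that(1)] \<sigma>_carrier \<sigma>_carrier, OF that(1,2) that(1,3)] k
    by simp
  have iter: "\<sigma> fpair State ((Star ?x ^^ n) ?s) = (Star p ^^ (k * n)) q" for n
  proof (induction n)
    case (Suc n)
    then show ?case
      using star[OF fpair_objs _ funpow_carrier[OF fpair_objs], of ?x ?x ?s n]
      by (simp add: funpow_add)
  qed simp
  \<comment> \<open>This element must be a value of \<sigma>, but the values on states of
    \<open>fpair\<close> are the iterates with exponent \<open>k * n\<close>. Hence
    \<open>k * n = 1\<close>.\<close>
  have "Star p q \<in> carrier (omap \<Phi> fpair) State"
    using funpow_carrier[OF omap_objs[OF fpair_objs] pq, of 1] by simp
  then obtain a where a: "a \<in> carrier fpair State" "Star p q = \<sigma> fpair State a"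
    using \<sigma>_surj[OF fpair_objs] by metis
  then obtain n where "a = (Star ?x ^^ n) ?s"
    using terms_pair_gens[of State a] by auto
  then have "(Star p ^^ (k * n)) q = (Star p ^^ 1) q"
    using a iter by simp
  then have "k = 1"
    by (simp only: funpow_Star_eq_iff) simp
  then show ?thesis
    using star[OF B b] by simp
qed

lemma \<sigma>_Circ:
  assumes B: "B \<in> objs X0" and b: "b1 \<in> carrier B Input" "b2 \<in> carrier B State"
  shows "\<sigma> B Output (Circ b1 b2) = Circ (\<sigma> B Input b1) (\<sigma> B State b2)"
proof -
  let ?x = "Var (e Input)" and ?s = "Var (e State)"
  have xs: "Circ ?x ?s \<in> carrier fpair Output" by (auto intro: terms.intros)
  obtain t where t: "t \<in> carrier fpair Output"
      "\<sigma> fpair Output (Circ ?x ?s) = pair_hom (omap \<Phi> fpair) p q Output t"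
    using pair_hom_surj[OF \<sigma>_carrier[OF fpair_objs xs]] by metis
  then obtain m where m: "t = Circ ?x ((Star ?x ^^ m) ?s)"
    using terms_pair_gens[of Output t] by auto
  have circ: "\<sigma> B Output (Circ b1 b2) = Circ (\<sigma> B Input b1) ((Star (\<sigma> B Input b1) ^^ m) (\<sigma> B State b2))"
    if "B \<in> objs X0" "b1 \<in> carrier B Input" "b2 \<in> carrier B State" for B b1 b2
    using \<sigma>_pair_hom[OF that t(1) xs t(2)] pair_hom_funpow(2)[OF that, of 0]
      pair_hom_funpow(2)[OF omap_objs[OF that(1)] \<sigma>_carrier \<sigma>_carrier, OF that(1,2) that(1,3)] m
    by simp
  have iter: "\<sigma> fpair State ((Star ?x ^^ n) ?s) = (Star p ^^ n) q" for n
  proof (induction n)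
    case (Suc n)
    then show ?case
      using \<sigma>_Star[OF fpair_objs _ funpow_carrier[OF fpair_objs], of ?x ?x ?s n] by simp
  qed simp
  \<comment> \<open>As an output of the image it is a value of \<sigma>. By \<open>circ\<close> and
    \<open>iter\<close>, such values apply \<open>p\<close> to a state with exponent
    \<open>m + n\<close>; here the exponent is 0, so \<open>m\<close> vanishes.\<close>
  have "Circ p q \<in> carrier (omap \<Phi> fpair) Output"
    using omap_objs[OF fpair_objs] pq by (auto elim!: objsE intro: terms.intros)
  then obtain a where a: "a \<in> carrier fpair Output" "Circ p q = \<sigma> fpair Output a"
    using \<sigma>_surj[OF fpair_objs] by metis
  then obtain n where "a = Circ ?x ((Star ?x ^^ n) ?s)"
    using terms_pair_gens[of Output a] by auto
  then have "(Star p ^^ (m + n)) q = (Star p ^^ 0) q"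
    using a circ[OF fpair_objs _ funpow_carrier[OF fpair_objs], of ?x ?x ?s n] iter[of n]
    by (simp add: funpow_add)
  then have "m = 0"
    by (simp only: funpow_Star_eq_iff)
  then show ?thesis
    using circ[OF B b] by simp
qed

lemma \<sigma>_homs:
  assumes "A \<in> objs X0"
  shows "\<sigma> A \<in> homs A (omap \<Phi> A)"
proof -
  have sel: "star B = Star" "circ B = Circ" if "B \<in> objs X0" for B
    using that by (auto elim: objsE)
  have "\<sigma> A i \<in> carrier A i \<rightarrow>\<^sub>E carrier (omap \<Phi> A) i" for i
    using \<sigma>_carrier[OF assms] by (auto simp: \<sigma>_def)
  then show ?thesis
    using \<sigma>_Star[OF assms] \<sigma>_Circ[OF assms] unfolding homs_def
    by (simp add: sel[OF assms] sel[OF omap_objs[OF assms]])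
qed

text \<open>The hypothesis on composites, applied to the homomorphisms from \<open>sg i\<close> that
  hit \<open>a\<close> and \<open>b\<close>, says that \<open>(a, b)\<close> lies in
  \<open>T\<close> exactly when the \<sigma>-images lie in \<open>U\<close>. With \<open>U\<close>
  the partner of \<open>T\<close> under \<alpha>, pulling back along \<sigma> undoes
  \<alpha>.\<close>

lemma pullback_\<sigma>:
  fixes H1 :: "'a automaton" and H2 :: "'b automaton"
  assumes A: "A \<in> objs X0" and T: "T \<in> Cl H1 A" and U: "U \<in> Cl H2 (omap \<Phi> A)"
    and iff: "\<And>i \<mu> \<nu>. \<mu> \<in> homs (sg i) A \<Longrightarrow> \<nu> \<in> homs (sg i) A \<Longrightarrow>
      comp_hom (sg i) (nat_epi A T) \<mu> = comp_hom (sg i) (nat_epi A T) \<nu> \<longleftrightarrow>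
      comp_hom (omap \<Phi> (sg i)) (nat_epi (omap \<Phi> A) U) (mmap \<Phi> (sg i) A \<mu>) =
      comp_hom (omap \<Phi> (sg i)) (nat_epi (omap \<Phi> A) U) (mmap \<Phi> (sg i) A \<nu>)"
  shows "pullback A (\<sigma> A) U = T"
proof -
  have "(\<sigma> A i a, \<sigma> A i b) \<in> U i \<longleftrightarrow> (a, b) \<in> T i"
    if ab: "a \<in> carrier A i" "b \<in> carrier A i" for i a b
    using iff[OF point_hom_homs[OF A ab(1)] point_hom_homs[OF A ab(2)]]
      nat_epi_comp_eq_iff[OF objs_is_automaton[OF A] T point_hom_homs[OF A ab(1)] point_hom_homs[OF A ab(2)]]
      nat_epi_comp_eq_iff[OF objs_is_automaton[OF omap_objs[OF A]] U
        mmap_point_homs[OF A ab(1)] mmap_point_homs[OF A ab(2)]]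
      point_hom_Var[OF A ab(1)] point_hom_Var[OF A ab(2)] ab
    by (simp add: \<sigma>_def omap_sg_eq)
  moreover have "T i \<subseteq> carrier A i \<times> carrier A i" for i
    using T by (auto simp: Cl_iff)
  ultimately show ?thesis
    unfolding pullback_def by fast
qed

end

section \<open>Automorphic and geometric equivalence\<close>

lemma theta0_automorphismI:
  assumes aut: "category_automorphism (Theta0 X0) \<Phi>" and e: "\<And>i. e i \<in> X0 i"
  shows "theta0_automorphism X0 e \<Phi>"
proof -
  obtain \<Psi> where \<Phi>: "is_functor (Theta0 X0) (Theta0 X0) \<Phi>"
    and \<Psi>: "is_functor (Theta0 X0) (Theta0 X0) \<Psi>"
    and left: "left_inverse_functor (Theta0 X0) \<Phi> \<Psi>"
    and right: "left_inverse_functor (Theta0 X0) \<Psi> \<Phi>"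
    using aut by (auto simp: category_automorphism_def)
  have sel: "Hom (Theta0 X0) = homs" "Id (Theta0 X0) = id_hom"
    "Comp (Theta0 X0) A B D g f = comp_hom A g f" for A B D g f
    by (simp_all add: Theta0_def)
  note \<Phi> = \<Phi>[unfolded is_functor_def sel] and \<Psi> = \<Psi>[unfolded is_functor_def sel]
    and left = left[unfolded left_inverse_functor_def sel]
    and right = right[unfolded left_inverse_functor_def sel]
  have obj: "omap \<Phi> A \<in> objs X0" "omap \<Psi> A \<in> objs X0" if "A \<in> objs X0" for A
    using \<Phi> \<Psi> that by auto
  have bij: "bij_betw (mmap \<Phi> A B) (homs A B) (homs (omap \<Phi> A) (omap \<Phi> B))"
    if AB: "A \<in> objs X0" "B \<in> objs X0" for A B
  proof (rule bij_betw_byWitness[where f' = "mmap \<Psi> (omap \<Phi> A) (omap \<Phi> B)"])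
    \<comment> \<open>The morphism part of \<Psi> lands in homomorphisms between the objects mapped
      forth and back; these identities make it a two-sided inverse on the required hom-sets.\<close>
    have inv: "omap \<Psi> (omap \<Phi> A) = A" "omap \<Psi> (omap \<Phi> B) = B"
      using left AB by auto
    show "\<forall>f\<in>homs A B. mmap \<Psi> (omap \<Phi> A) (omap \<Phi> B) (mmap \<Phi> A B f) = f"
      using left AB by auto
    show "\<forall>g\<in>homs (omap \<Phi> A) (omap \<Phi> B). mmap \<Phi> A B (mmap \<Psi> (omap \<Phi> A) (omap \<Phi> B) g) = g"
      using right obj(1)[OF AB(1)] obj(1)[OF AB(2)] inv by metis
    show "mmap \<Phi> A B ` homs A B \<subseteq> homs (omap \<Phi> A) (omap \<Phi> B)"
      using \<Phi> AB by blast
    have "mmap \<Psi> (omap \<Phi> A) (omap \<Phi> B) \<in> homs (omap \<Phi> A) (omap \<Phi> B) \<rightarrow>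
        homs (omap \<Psi> (omap \<Phi> A)) (omap \<Psi> (omap \<Phi> B))"
      using \<Psi> obj(1)[OF AB(1)] obj(1)[OF AB(2)] by blast
    then show "mmap \<Psi> (omap \<Phi> A) (omap \<Phi> B) ` homs (omap \<Phi> A) (omap \<Phi> B) \<subseteq> homs A B"
      unfolding inv by blast
  qed
  show ?thesis
  proof
    show "\<exists>A\<in>objs X0. B = omap \<Phi> A" if "B \<in> objs X0" for B
      using right obj(2)[OF that] that by metis
    show "mmap \<Phi> A A (id_hom A) = id_hom (omap \<Phi> A)" if "A \<in> objs X0" for A
      using \<Phi> that by blast
    show "mmap \<Phi> A C (comp_hom A g f) = comp_hom (omap \<Phi> A) (mmap \<Phi> B C g) (mmap \<Phi> A B f)"
      if "A \<in> objs X0" "B \<in> objs X0" "C \<in> objs X0" "f \<in> homs A B" "g \<in> homs B C" for A B C f g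
      using \<Phi> that by blast
  qed (use e obj bij in auto)
qed

theorem theorem5p2:
  fixes X0 :: "gamma \<Rightarrow> 'x set"
    and H1 :: "'a automaton" and H2 :: "'b automaton"
  assumes "\<And>i. countable (X0 i)" and "\<And>i. infinite (X0 i)"
    and "is_automaton H1" and "is_automaton H2"
  shows "automorphically_equivalent X0 H1 H2 \<longleftrightarrow> geometrically_equivalent X0 H1 H2"
proof
  assume "automorphically_equivalent X0 H1 H2"
  then obtain \<Phi> \<alpha> where aut: "category_automorphism (Theta0 X0) \<Phi>"
    and \<alpha>: "\<And>A. A \<in> objs X0 \<Longrightarrow> bij_betw (\<alpha> A) (Cl H1 A) (Cl H2 (omap \<Phi> A))"
    and iff: "\<And>A1 A2 \<mu>1 \<mu>2 T. A1 \<in> objs X0 \<Longrightarrow> A2 \<in> objs X0 \<Longrightarrow> \<mu>1 \<in> homs A1 A2 \<Longrightarrow>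
      \<mu>2 \<in> homs A1 A2 \<Longrightarrow> T \<in> Cl H1 A2 \<Longrightarrow>
      comp_hom A1 (nat_epi A2 T) \<mu>1 = comp_hom A1 (nat_epi A2 T) \<mu>2 \<longleftrightarrow>
      comp_hom (omap \<Phi> A1) (nat_epi (omap \<Phi> A2) (\<alpha> A2 T)) (mmap \<Phi> A1 A2 \<mu>1) =
      comp_hom (omap \<Phi> A1) (nat_epi (omap \<Phi> A2) (\<alpha> A2 T)) (mmap \<Phi> A1 A2 \<mu>2)"
    unfolding automorphically_equivalent_def by blast
  have "\<exists>x. x \<in> X0 i" for i
    using assms(2)[of i] by (metis all_not_in_conv finite.emptyI)
  then obtain e where "\<And>i. e i \<in> X0 i"
    by metis
  then interpret theta0_automorphism X0 e \<Phi>
    using aut theta0_automorphismI by blast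
  have "Cl H1 A = Cl H2 A" if A: "A \<in> objs X0" for A
  proof
    have \<alpha>_Cl: "\<alpha> A T \<in> Cl H2 (omap \<Phi> A)" if "T \<in> Cl H1 A" for T
      using \<alpha>[OF A] that bij_betwE by blast
    have pull: "pullback A (\<sigma> A) (\<alpha> A T) = T" if "T \<in> Cl H1 A" for T
      by (rule pullback_\<sigma>[OF A that \<alpha>_Cl[OF that]]) (rule iff[OF sg_objs A _ _ that])
    note pull_Cl = pullback_Cl[OF objs_is_automaton[OF A] \<sigma>_homs[OF A]]
    \<comment> \<open>A relation \<open>T\<close> closed over \<open>H1\<close> is the pullback of
      \<open>\<alpha> A T\<close>, which is closed over \<open>H2\<close>, and pullbacks stay
      closed.\<close>
    show "Cl H1 A \<subseteq> Cl H2 A"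
      using pull pull_Cl \<alpha>_Cl by (metis subsetI)
    show "Cl H2 A \<subseteq> Cl H1 A"
    proof
      fix T assume T: "T \<in> Cl H2 A"
      obtain \<rho> where \<rho>: "\<rho> \<in> homs (omap \<Phi> A) A" "\<And>i a. a \<in> carrier A i \<Longrightarrow> \<rho> i (\<sigma> A i a) = a"
        using inverse_hom[OF objs_is_automaton[OF A] \<sigma>_homs[OF A] \<sigma>_bij[OF A]] by blast
      \<comment> \<open>Transporting \<open>T\<close> along the inverse of \<sigma> gives a closed
        relation over \<open>H2\<close>, hence a value of \<alpha> at some \<open>T'\<close> closed
        over \<open>H1\<close>. Pulling it back along \<sigma> gives both \<open>T\<close> and
        \<open>T'\<close>.\<close>
      let ?U = "pullback (omap \<Phi> A) \<rho> T"
      have "?U \<in> Cl H2 (omap \<Phi> A)"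
        by (rule pullback_Cl[OF objs_is_automaton[OF omap_objs[OF A]] \<rho>(1) T])
      then obtain T' where T': "T' \<in> Cl H1 A" "?U = \<alpha> A T'"
        using bij_betw_imp_surj_on[OF \<alpha>[OF A]] by blast
      have "T i \<subseteq> carrier A i \<times> carrier A i" for i
        using T by (auto simp: Cl_iff)
      then have "pullback A (\<sigma> A) ?U = T"
        unfolding pullback_def using \<rho>(2) \<sigma>_carrier[OF A] by (fastforce simp: fun_eq_iff)
      then have "T = T'"
        using T' pull by simp
      then show "T \<in> Cl H1 A"
        using T' by simp
    qed
  qed
  then show "geometrically_equivalent X0 H1 H2"
    unfolding geometrically_equivalent_def by (blast intro: alg_closure_cong)
next
  assume geo: "geometrically_equivalent X0 H1 H2"
  \<comment> \<open>With equal families of closed relations, the identity functor and identity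
    bijections are witnesses, and the condition on composites is trivial.\<close>
  let ?I = "\<lparr>omap = (\<lambda>A. A), mmap = (\<lambda>A B f. f)\<rparr>"
  have "is_functor (Theta0 X0) (Theta0 X0) ?I" "left_inverse_functor (Theta0 X0) ?I ?I"
    by (auto simp: is_functor_def left_inverse_functor_def Theta0_def)
  then have "category_automorphism (Theta0 X0) ?I"
    unfolding category_automorphism_def by blast
  moreover have "bij_betw (\<lambda>T. T) (Cl H1 A) (Cl H2 A)" if "A \<in> objs X0" for A
  proof -
    have "Cl H1 A = Cl H2 A"
      using geo that by (auto simp: geometrically_equivalent_def Cl_def)
    then show ?thesis
      by (simp add: bij_betw_def inj_on_def)
  qed
  ultimately show "automorphically_equivalent X0 H1 H2"
    unfolding automorphically_equivalent_def
    by (intro exI[of _ ?I] exI[of _ "\<lambda>A T. T"]) simp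
qed

end
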